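(* Let $m \geq n \geq 1$ be integers, let $A$ be a real $m\times n$ matrix of full rank (i.e. of rank $n$), and let $b \in \mathbb{R}^m$ be an arbitrary column vector. Let $\mathcal{P}=\{p\subseteq\{1,\dots,m\} : |p|=n\}$, and define $$\hat{x}_{\mathsf{LS}}=\frac{\sum_{p \in \mathcal{P}} \det(A_p)^2\, A_p^{-1} b_p}{\sum_{p \in \mathcal{P}} \det(A_p)^2},$$ where terms in the numerator with $\det(A_p)=0$ are taken to be $0$. Then $$\hat{x}_{\mathsf{LS}}=(A^t A)^{-1} A^t b,$$ i.e. $\hat{x}_{\mathsf{LS}}$ coincides with the least-square solution of $Ax=b$.
   Context: For $p \subseteq \{1,\dots,m\}$ with $|p|=n$, $A_p$ denotes the $n\times n$ matrix obtained from $A$ by selecting the rows with index in $p$, keeping their order as in $A$; $b_p\in\mathbb{R}^n$ denotes the sub-vector of $b$ consisting of the components with index in $p$, in the same order as in $b$. $A^t$ denotes the transpose of $A$. Convention: if $\det(A_p)=0$, then $A_p^{-1}$ does not exist and the term $\det(A_p)^2 A_p^{-1} b_p$ is understood to be $0$ (its weight is $0$). Since $A$ has full rank, at least one $\det(A_p)$ is nonzero, so the denominator is nonzero. The least-square solution of $Ax=b$ is the unique $x\in\mathbb{R}^n$ minimizing $\|Ax-b\|_2$, and is given by $(A^tA)^{-1}A^t b$. *)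

theory Defs
  imports
    Complex_Main
    "Jordan_Normal_Form.DL_Rank"
    "Jordan_Normal_Form.DL_Submatrix"
    "Jordan_Normal_Form.Gauss_Jordan_Elimination"
begin

text \<open>
  Rows and components are indexed from 0, so the index sets are subsets of
  \<open>{..<m}\<close> instead of \<open>{1..m}\<close>. The \<open>i\<close>-th smallest element of
  \<open>p\<close> is \<open>pick p i\<close>, hence \<open>submatrix\<close> and \<open>subvec\<close> keep the original order.
\<close>

definition row_subsets :: "real mat \<Rightarrow> nat set set" where
  "row_subsets A = {p. p \<subseteq> {..<dim_row A} \<and> card p = dim_col A}"

definition row_submatrix :: "real mat \<Rightarrow> nat set \<Rightarrow> real mat" where
  "row_submatrix A p = submatrix A p UNIV"

definition subvec :: "real vec \<Rightarrow> nat set \<Rightarrow> real vec" where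
  "subvec b p = vec (card {i. i < dim_vec b \<and> i \<in> p}) (\<lambda>i. b $ pick p i)"

text \<open>\<open>mat_inverse\<close> is \<open>None\<close> on singular matrices, where \<open>mat_inv\<close> is unspecified.\<close>

definition mat_inv :: "real mat \<Rightarrow> real mat" where
  "mat_inv M = the (mat_inverse M)"

definition ls_weighted_term :: "real mat \<Rightarrow> real vec \<Rightarrow> nat set \<Rightarrow> real vec" where
  "ls_weighted_term A b p =
     (if det (row_submatrix A p) = 0 then 0\<^sub>v (dim_col A)
      else (det (row_submatrix A p))\<^sup>2 \<cdot>\<^sub>v (mat_inv (row_submatrix A p) *\<^sub>v subvec b p))"

definition ls_denominator :: "real mat \<Rightarrow> real" where
  "ls_denominator A = (\<Sum>p\<in>row_subsets A. (det (row_submatrix A p))\<^sup>2)"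

definition ls_estimate :: "real mat \<Rightarrow> real vec \<Rightarrow> real vec" where
  "ls_estimate A b =
     (1 / ls_denominator A) \<cdot>\<^sub>v
       finsum_vec TYPE(real) (dim_col A) (ls_weighted_term A b) (row_subsets A)"

definition euclidean_norm :: "real vec \<Rightarrow> real" where
  "euclidean_norm v = sqrt (v \<bullet> v)"

definition least_square_solution :: "real mat \<Rightarrow> real vec \<Rightarrow> real vec \<Rightarrow> bool" where
  "least_square_solution A b x \<longleftrightarrow>
     is_arg_min (\<lambda>y. euclidean_norm (A *\<^sub>v y - b)) (\<lambda>y. y \<in> carrier_vec (dim_col A)) x"

end

theory Submission
  imports Defs
begin

text \<open>
  The estimate \<open>x\<close> solves the normal equations \<open>A\<^sup>T (b - A x) = 0\<close>; everything else follows from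
  this. Since \<open>x\<close> is a weighted mean of the solutions \<open>x\<^sub>p\<close> of the square subsystems, its residual is the
  same mean of their residuals. So the claim is that the weighted residuals
  \<open>det(A\<^sub>p)\<^sup>2 (b - A x\<^sub>p)\<close> add up to a vector orthogonal to every column of \<open>A\<close>.

  The residual of \<open>x\<^sub>p\<close> vanishes on the rows in \<open>p\<close>. At a row \<open>k\<close> outside \<open>p\<close> put
  \<open>q = p \<union> {k}\<close>, and let \<open>c\<^sub>q(k)\<close> be the signed minor \<open>\<plusminus> det(A\<^sub>p)\<close>, that is, the cofactor of the entry in row
  \<open>k\<close> and the last column when a column is appended to the \<open>n + 1\<close> rows \<open>q\<close> of \<open>A\<close>. If the appended column is
  already a column of \<open>A\<close>, the determinant is zero, so \<open>c\<^sub>q\<close> is orthogonal to the columns of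
  \<open>A\<close> restricted to \<open>q\<close> (\<open>row_cofactor_orthogonal_col\<close>). Pairing \<open>c\<^sub>q\<close> with \<open>b - A x\<^sub>p\<close> hence gives
  \<open>c\<^sub>q(k) (b - A x\<^sub>p)\<^sub>k = D\<^sub>q\<close>, where \<open>D\<^sub>q\<close> is the determinant with \<open>b\<close> appended. The weighted
  residual at \<open>k\<close> is therefore \<open>c\<^sub>q(k) D\<^sub>q\<close> (\<open>weighted_residual_other_row\<close>), also when \<open>A\<^sub>p\<close> is
  singular. Summing over \<open>p\<close> and \<open>k\<close> is summing over \<open>q\<close> and \<open>k \<in> q\<close>, and for each
  \<open>q\<close> the pairing with a column of \<open>A\<close> vanishes by the same orthogonality
  (\<open>sum_weighted_residual_orthogonal\<close>). This replaces the Cauchy-Binet formula by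
  Laplace expansion along a single column.

  Full rank enters twice: some \<open>det(A\<^sub>p)\<close> is nonzero (\<open>exists_nonzero_maximal_minor\<close>), so the mean is
  defined, and \<open>A\<^sup>T A\<close> is invertible (\<open>det_gram_nonzero\<close>), so the normal equations determine \<open>x\<close>. Their
  solution is the unique minimizer by Pythagoras (\<open>normal_equations_unique_minimizer\<close>).
\<close>

section \<open>Full rank and nonzero maximal minors\<close>

lemma index_mult_mat_vec_sum:
  assumes "M \<in> carrier_mat r c" "v \<in> carrier_vec c" "i < r"
  shows "(M *\<^sub>v v) $ i = (\<Sum>j<c. M $$ (i, j) * v $ j)"
  using assms by (simp add: scalar_prod_def atLeast0LessThan)

text \<open>Padding with zero rows makes the matrix square and singular.\<close>

lemma wide_mat_kernel:
  fixes M :: "'a :: field mat"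
  assumes M: "M \<in> carrier_mat r c" and "r < c"
  obtains v where "v \<in> carrier_vec c" "v \<noteq> 0\<^sub>v c" "M *\<^sub>v v = 0\<^sub>v r"
proof -
  define B where "B = mat c c (\<lambda>(i, j). if i < r then M $$ (i, j) else 0)"
  have B: "B \<in> carrier_mat c c" by (simp add: B_def)
  have "det B = (\<Sum>j<c. B $$ (r, j) * cofactor B r j)"
    by (rule laplace_expansion_row[OF B \<open>r < c\<close>])
  also have "\<dots> = 0" using \<open>r < c\<close> by (intro sum.neutral) (simp add: B_def)
  finally obtain v where v: "v \<in> carrier_vec c" "v \<noteq> 0\<^sub>v c" "B *\<^sub>v v = 0\<^sub>v c"
    using det_0_iff_vec_prod_zero_field[OF B] by blast
  have "M *\<^sub>v v = 0\<^sub>v r"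
  proof (rule eq_vecI)
    fix i assume i: "i < dim_vec (0\<^sub>v r)"
    have "row B i = row M i"
      using i M \<open>r < c\<close> by (intro eq_vecI) (auto simp: B_def)
    then have "(M *\<^sub>v v) $ i = (B *\<^sub>v v) $ i"
      using i M B \<open>r < c\<close> by simp
    then show "(M *\<^sub>v v) $ i = 0\<^sub>v r $ i"
      using i v(3) \<open>r < c\<close> by simp
  qed (use M in simp)
  with v that show thesis by blast
qed

text \<open>
  Full column rank is used below only in this form. Kernel vectors give linear dependences of
  the set of columns only if the columns are pairwise distinct; a repeated column would leave fewer than
  \<open>n\<close> vectors to span the column space.
\<close>

lemma full_column_rank_kernel:
  fixes A :: "'a :: field mat"
  assumes A: "A \<in> carrier_mat m n" and rank: "vec_space.rank m A = n"
  shows "\<forall>x\<in>carrier_vec n. A *\<^sub>v x = 0\<^sub>v m \<longrightarrow> x = 0\<^sub>v n"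
proof -
  interpret vec_space "TYPE('a)" m .
  have distinct: "distinct (cols A)"
  proof -
    obtain S where S: "maximal S (\<lambda>T. T \<subseteq> set (cols A) \<and> lin_indpt T)"
      using maximal_exists[of "\<lambda>T. T \<subseteq> set (cols A) \<and> lin_indpt T" "card (set (cols A))" "{}"]
      by (meson List.finite_set card_mono empty_iff empty_subsetI finite_lin_indpt2 rev_finite_subset)
    have "length (cols A) = card S"
      using rank_card_indpt[OF A S] rank A by simp
    also have "\<dots> \<le> card (set (cols A))"
      using S by (simp add: card_mono maximal_def)
    finally have "card (set (cols A)) = length (cols A)"
      using card_length le_antisym by blast
    then show ?thesis by (rule card_distinct)
  qed
  then show ?thesis
    using full_rank_lin_indpt[OF A rank] lin_depI[OF A] by blast
qed

lemma inter_below: "p \<subseteq> {..<m} \<Longrightarrow> {i. i < m \<and> i \<in> p} = p"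
  by auto

lemma row_submatrix_carrier:
  "p \<subseteq> {..<dim_row A} \<Longrightarrow> row_submatrix A p \<in> carrier_mat (card p) (dim_col A)"
  by (intro carrier_matI) (simp_all add: row_submatrix_def dim_submatrix inter_below)

lemma row_submatrix_index:
  assumes "p \<subseteq> {..<dim_row A}" "i < card p" "j < dim_col A"
  shows "row_submatrix A p $$ (i, j) = A $$ (pick p i, j)"
  using assms by (simp add: row_submatrix_def submatrix_index inter_below pick_UNIV)

lemma pick_below: "p \<subseteq> {..<m} \<Longrightarrow> i < card p \<Longrightarrow> pick p i < m"
  using pick_in_set_le by blast

lemma bij_betw_pick:
  assumes "finite p"
  shows "bij_betw (pick p) {..<card p} p"
proof (rule bij_betw_byWitness[where f' = "\<lambda>k. card {a \<in> p. a < k}"])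
  show "(\<lambda>k. card {a \<in> p. a < k}) ` p \<subseteq> {..<card p}"
    using assms by (auto intro!: psubset_card_mono)
qed (auto simp: card_pick_le pick_card_in_set pick_in_set_le)

lemma row_submatrix_mult_vec:
  assumes p: "p \<subseteq> {..<dim_row A}" and x: "x \<in> carrier_vec (dim_col A)"
  shows "row_submatrix A p *\<^sub>v x = subvec (A *\<^sub>v x) p"
proof (rule eq_vecI)
  fix i assume "i < dim_vec (subvec (A *\<^sub>v x) p)"
  then have i: "i < card p" by (simp add: subvec_def inter_below p)
  have "row (row_submatrix A p) i = row A (pick p i)"
    using row_submatrix_carrier[OF p] i pick_below[OF p i]
    by (intro eq_vecI) (auto simp: row_submatrix_index[OF p])
  then show "(row_submatrix A p *\<^sub>v x) $ i = subvec (A *\<^sub>v x) p $ i"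
    using row_submatrix_carrier[OF p] i pick_below[OF p i]
    by (simp add: subvec_def inter_below p)
qed (use row_submatrix_carrier[OF p] in \<open>simp add: subvec_def inter_below p\<close>)

lemma subvec_eq_iff:
  assumes "p \<subseteq> {..<dim_vec u}" "dim_vec u = dim_vec v"
  shows "subvec u p = subvec v p \<longleftrightarrow> (\<forall>k\<in>p. u $ k = v $ k)"
proof -
  have "finite p" using assms(1) finite_subset by blast
  then have image: "pick p ` {..<card p} = p"
    using bij_betw_pick bij_betw_imp_surj_on by blast
  have "(\<forall>k\<in>p. u $ k = v $ k) \<longleftrightarrow> (\<forall>k\<in>pick p ` {..<card p}. u $ k = v $ k)"
    by (simp only: image)
  also have "\<dots> \<longleftrightarrow> (\<forall>i<card p. u $ pick p i = v $ pick p i)"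
    by auto
  finally have "(\<forall>k\<in>p. u $ k = v $ k) \<longleftrightarrow> (\<forall>i<card p. u $ pick p i = v $ pick p i)" .
  then show ?thesis
    using assms by (auto simp: subvec_def inter_below vec_eq_iff)
qed

text \<open>
  Choose a set \<open>p\<close> of rows that is minimal among those on which \<open>A x = 0\<close> forces \<open>x = 0\<close>.
  It has at least \<open>n\<close> elements because a wide matrix has a nonzero kernel vector. By minimality
  every \<open>k \<in> p\<close> has a vector \<open>dual k\<close> whose image under \<open>A\<close> vanishes at
  all of \<open>p\<close> except \<open>k\<close>. If \<open>p\<close> had more than \<open>n\<close> elements, these vectors would be linearly
  dependent, and evaluating the dependence at the rows in \<open>p\<close> would kill each coefficient.
\<close>

lemma exists_nonzero_maximal_minor:
  assumes A: "A \<in> carrier_mat m n"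
    and inj: "\<forall>x\<in>carrier_vec n. A *\<^sub>v x = 0\<^sub>v m \<longrightarrow> x = 0\<^sub>v n"
  obtains p where "p \<in> row_subsets A" "det (row_submatrix A p) \<noteq> 0"
proof -
  define determining where "determining p \<longleftrightarrow>
    p \<subseteq> {..<m} \<and> (\<forall>x\<in>carrier_vec n. (\<forall>k\<in>p. (A *\<^sub>v x) $ k = 0) \<longrightarrow> x = 0\<^sub>v n)" for p
  have "determining {..<m}"
    using A inj by (auto simp: determining_def vec_eq_iff)
  then obtain p where p: "determining p" and
    minimal: "\<And>p'. p' \<subset> p \<Longrightarrow> \<not> determining p'"
  proof -
    assume *: "\<And>p. determining p \<Longrightarrow> (\<And>p'. p' \<subset> p \<Longrightarrow> \<not> determining p') \<Longrightarrow> thesis"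
    have "finite {p. determining p}"
      by (rule finite_subset[of _ "Pow {..<m}"]) (auto simp: determining_def)
    then show thesis
      using finite_has_minimal[of "{p. determining p}"] \<open>determining {..<m}\<close> *
      by (metis empty_iff mem_Collect_eq psubset_eq)
  qed
  have sub: "p \<subseteq> {..<dim_row A}" using p A by (simp add: determining_def)
  then have "finite p" using finite_subset by blast
  have Ap: "row_submatrix A p \<in> carrier_mat (card p) n"
    using row_submatrix_carrier[OF sub] A by simp
  have kernel: "x = 0\<^sub>v n"
    if x: "x \<in> carrier_vec n" and "row_submatrix A p *\<^sub>v x = 0\<^sub>v (card p)" for x
  proof -
    have "subvec (A *\<^sub>v x) p = subvec (0\<^sub>v m) p"
      using that row_submatrix_mult_vec[OF sub, of x] A sub
      by (auto simp: subvec_def inter_below vec_eq_iff dest: pick_below)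
    then have "\<forall>k\<in>p. (A *\<^sub>v x) $ k = 0\<^sub>v m $ k"
      using subvec_eq_iff[of p "A *\<^sub>v x" "0\<^sub>v m"] A sub by simp
    then have "\<forall>k\<in>p. (A *\<^sub>v x) $ k = 0" using sub A by auto
    then show ?thesis using p x by (simp add: determining_def)
  qed
  have "n \<le> card p"
    using wide_mat_kernel[OF Ap] kernel by (metis not_less)
  moreover have "card p \<le> n"
  proof (rule ccontr)
    assume "\<not> card p \<le> n"
    have "\<exists>x\<in>carrier_vec n. (\<forall>l\<in>p - {k}. (A *\<^sub>v x) $ l = 0) \<and> (A *\<^sub>v x) $ k \<noteq> 0"
      if k: "k \<in> p" for k
    proof -
      obtain x where x: "x \<in> carrier_vec n" "\<forall>l\<in>p - {k}. (A *\<^sub>v x) $ l = 0" "x \<noteq> 0\<^sub>v n"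
        using minimal[of "p - {k}"] k p by (auto simp: determining_def)
      moreover have "(A *\<^sub>v x) $ k \<noteq> 0"
        using p x by (auto simp: determining_def)
      ultimately show ?thesis by blast
    qed
    then obtain dual where "\<forall>k\<in>p. dual k \<in> carrier_vec n \<and>
        (\<forall>l\<in>p - {k}. (A *\<^sub>v dual k) $ l = 0) \<and> (A *\<^sub>v dual k) $ k \<noteq> 0"
      by metis
    then have dual: "dual k \<in> carrier_vec n" "(A *\<^sub>v dual k) $ k \<noteq> 0"
      "\<And>l. l \<in> p \<Longrightarrow> l \<noteq> k \<Longrightarrow> (A *\<^sub>v dual k) $ l = 0" if "k \<in> p" for k
      using that by auto
    define X where "X = mat n (card p) (\<lambda>(i, j). dual (pick p j) $ i)"
    have X: "X \<in> carrier_mat n (card p)" by (simp add: X_def)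
    obtain y where y: "y \<in> carrier_vec (card p)" "y \<noteq> 0\<^sub>v (card p)" "X *\<^sub>v y = 0\<^sub>v n"
      using wide_mat_kernel[OF X] \<open>\<not> card p \<le> n\<close> by (metis not_less)
    have "y $ i = 0" if i: "i < card p" for i
    proof -
      let ?k = "pick p i"
      have k: "?k \<in> p" "?k < m" using i pick_in_set_le pick_below[OF sub i] A by auto
      have AX: "(A * X) $$ (?k, j) = (A *\<^sub>v dual (pick p j)) $ ?k" if "j < card p" for j
      proof -
        have "col X j = dual (pick p j)"
          using that dual(1)[OF pick_in_set_le[OF that]] by (intro eq_vecI) (auto simp: X_def)
        then show ?thesis using that k A X by simp
      qed
      have "0 = (A *\<^sub>v (X *\<^sub>v y)) $ ?k" using y k A by simp
      also have "\<dots> = ((A * X) *\<^sub>v y) $ ?k"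
        using assoc_mult_mat_vec[OF A X y(1)] by simp
      also have "\<dots> = (\<Sum>j<card p. (A * X) $$ (?k, j) * y $ j)"
        by (rule index_mult_mat_vec_sum[OF mult_carrier_mat[OF A X] y(1) k(2)])
      also have "\<dots> = (\<Sum>j<card p. if j = i then (A *\<^sub>v dual ?k) $ ?k * y $ i else 0)"
      proof (rule sum.cong[OF refl])
        fix j assume "j \<in> {..<card p}"
        then have j: "j < card p" by simp
        have "pick p j \<noteq> ?k" if "j \<noteq> i"
          using that i j card_pick_le by metis
        then show "(A * X) $$ (?k, j) * y $ j = (if j = i then (A *\<^sub>v dual ?k) $ ?k * y $ i else 0)"
          using AX[OF j] dual(3)[OF pick_in_set_le[OF j] k(1)] by auto
      qed
      also have "\<dots> = (A *\<^sub>v dual ?k) $ ?k * y $ i" using i by simp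
      finally show ?thesis using dual(2)[OF k(1)] by simp
    qed
    then show False using y by (auto simp: vec_eq_iff)
  qed
  ultimately have card: "card p = n" by simp
  then have "p \<in> row_subsets A" using sub A by (simp add: row_subsets_def)
  moreover have "det (row_submatrix A p) \<noteq> 0"
    using det_0_iff_vec_prod_zero_field[of "row_submatrix A p" n] Ap kernel card by auto
  ultimately show thesis using that by blast
qed

section \<open>Cofactors along an appended column\<close>

text \<open>
  Deleting a row commutes with selecting rows: this identifies the minors in a Laplace expansion of
  a row submatrix with row submatrices again.
\<close>

lemma pick_remove:
  assumes i: "i < card q" and j: "Suc j < card q"
  shows "pick (q - {pick q i}) j = pick q (insert_index i j)"
proof -
  let ?x = "pick q (insert_index i j)"
  have "finite q" using i card.infinite by fastforce
  have lt: "insert_index i j < card q" using j by (simp add: insert_index_def)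
  have below: "{a \<in> q - {pick q i}. a < ?x} = {a \<in> q. a < ?x} - {pick q i}" by auto
  have "insert_index i j \<noteq> i" by (simp add: insert_index_def)
  then have "?x \<noteq> pick q i" using card_pick_le i lt by metis
  moreover have "card {a \<in> q - {pick q i}. a < ?x} = j"
  proof (cases "j < i")
    case True
    then have "pick q j < pick q i" using pick_mono_le i by blast
    then have "{a \<in> q. a < ?x} - {pick q i} = {a \<in> q. a < ?x}" using True by auto
    then show ?thesis unfolding below using True card_pick_le[OF lt] by simp
  next
    case False
    then have "pick q i < ?x" using pick_mono_le[OF lt] by simp
    then have "pick q i \<in> {a \<in> q. a < ?x}" using pick_in_set_le[OF i] by simp
    then show ?thesis
      unfolding below using False card_pick_le[OF lt] \<open>finite q\<close> by (simp add: card_Diff_singleton)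
  qed
  ultimately show ?thesis
    using pick_card_in_set[of ?x "q - {pick q i}"] pick_in_set_le[OF lt] by simp
qed

text \<open>
  For a set \<open>q\<close> of \<open>n + 1\<close> rows, \<open>row_cofactor A q k\<close> is the cofactor belonging to row \<open>k\<close> and
  the last column when any column is appended to the rows \<open>q\<close> of \<open>A\<close>. It is indexed by the
  row number \<open>k\<close> in \<open>A\<close> rather than by its position in \<open>q\<close>, so that sums over pairs of a set
  and a row can be reindexed without the enumeration \<open>pick\<close>; the cardinality in the
  exponent recovers the position.
\<close>

definition row_cofactor :: "real mat \<Rightarrow> nat set \<Rightarrow> nat \<Rightarrow> real" where
  "row_cofactor A q k = (-1) ^ (card {l \<in> q. l < k} + dim_col A) * det (row_submatrix A (q - {k}))"

definition append_column :: "real mat \<Rightarrow> real vec \<Rightarrow> real mat" where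
  "append_column A v = mat (dim_row A) (Suc (dim_col A))
     (\<lambda>(i, j). if j < dim_col A then A $$ (i, j) else v $ i)"

lemma append_column_simps [simp]:
  "dim_row (append_column A v) = dim_row A"
  "dim_col (append_column A v) = Suc (dim_col A)"
  "i < dim_row A \<Longrightarrow> j < dim_col A \<Longrightarrow> append_column A v $$ (i, j) = A $$ (i, j)"
  "i < dim_row A \<Longrightarrow> append_column A v $$ (i, dim_col A) = v $ i"
  by (simp_all add: append_column_def)

lemma det_append_column:
  assumes q: "q \<subseteq> {..<dim_row A}" "card q = Suc (dim_col A)"
  shows "det (row_submatrix (append_column A v) q) = (\<Sum>k\<in>q. row_cofactor A q k * v $ k)"
proof -
  let ?n = "dim_col A" and ?M = "append_column A v"
  have "finite q" using q(2) card.infinite by fastforce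
  have qM: "q \<subseteq> {..<dim_row ?M}" using q by simp
  have S: "row_submatrix ?M q \<in> carrier_mat (Suc ?n) (Suc ?n)"
    using row_submatrix_carrier[OF qM] q by simp
  have cofactor: "cofactor (row_submatrix ?M q) i ?n = row_cofactor A q (pick q i)"
    if i: "i < Suc ?n" for i
  proof -
    have "pick q i \<in> q" using i q pick_in_set_le by simp
    then have card': "card (q - {pick q i}) = ?n" using q by simp
    have sub': "q - {pick q i} \<subseteq> {..<dim_row A}" using q by auto
    have "mat_delete (row_submatrix ?M q) i ?n = row_submatrix A (q - {pick q i})"
    proof (rule eq_matI)
      fix i' j'
      assume "i' < dim_row (row_submatrix A (q - {pick q i}))"
        and "j' < dim_col (row_submatrix A (q - {pick q i}))"
      then have i': "i' < ?n" and j': "j' < ?n"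
        using row_submatrix_carrier[OF sub'] card' by simp_all
      have lt: "insert_index i i' < card q" using i' q by (simp add: insert_index_def)
      have "mat_delete (row_submatrix ?M q) i ?n $$ (i', j')
          = row_submatrix ?M q $$ (insert_index i i', insert_index ?n j')"
        using mat_delete_index[OF S i _ i' j', of ?n] by simp
      also have "\<dots> = ?M $$ (pick q (insert_index i i'), j')"
        using row_submatrix_index[OF qM lt, of j'] j' by simp
      also have "\<dots> = A $$ (pick q (insert_index i i'), j')"
        using j' pick_below[OF q(1) lt] by simp
      also have "\<dots> = row_submatrix A (q - {pick q i}) $$ (i', j')"
        using row_submatrix_index[OF sub', of i' j'] i' j' card' pick_remove[of i q i'] i q by simp
      finally show "mat_delete (row_submatrix ?M q) i ?n $$ (i', j')
          = row_submatrix A (q - {pick q i}) $$ (i', j')" .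
    qed (use S row_submatrix_carrier[OF sub'] card' in simp_all)
    then show ?thesis
      using i q by (simp add: cofactor_def row_cofactor_def card_pick_le)
  qed
  have "det (row_submatrix ?M q)
      = (\<Sum>i<Suc ?n. row_submatrix ?M q $$ (i, ?n) * cofactor (row_submatrix ?M q) i ?n)"
    by (rule laplace_expansion_column[OF S]) simp
  also have "\<dots> = (\<Sum>i<card q. row_cofactor A q (pick q i) * v $ pick q i)"
    using q pick_below[OF q(1)]
    by (intro sum.cong) (auto simp: cofactor row_submatrix_index[OF qM])
  also have "\<dots> = (\<Sum>k\<in>q. row_cofactor A q k * v $ k)"
    by (rule sum.reindex_bij_betw[OF bij_betw_pick[OF \<open>finite q\<close>]])
  finally show ?thesis .
qed

text \<open>Appending a column that is already present gives a vanishing determinant.\<close>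

lemma row_cofactor_orthogonal_col:
  assumes q: "q \<subseteq> {..<dim_row A}" "card q = Suc (dim_col A)" and j: "j < dim_col A"
  shows "(\<Sum>k\<in>q. row_cofactor A q k * A $$ (k, j)) = 0"
proof -
  let ?n = "dim_col A" and ?M = "append_column A (col A j)"
  have qM: "q \<subseteq> {..<dim_row ?M}" using q by simp
  have S: "row_submatrix ?M q \<in> carrier_mat (Suc ?n) (Suc ?n)"
    using row_submatrix_carrier[OF qM] q by simp
  have "col (row_submatrix ?M q) j = col (row_submatrix ?M q) ?n"
    using S j q pick_below[OF q(1)]
    by (intro eq_vecI) (auto simp: row_submatrix_index[OF qM])
  then have "det (row_submatrix ?M q) = 0"
    using det_identical_columns[OF S, of j ?n] j by simp
  moreover have "(\<Sum>k\<in>q. row_cofactor A q k * A $$ (k, j)) = (\<Sum>k\<in>q. row_cofactor A q k * col A j $ k)"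
    using q j by (intro sum.cong) auto
  ultimately show ?thesis using det_append_column[OF q, of "col A j"] by simp
qed

lemma row_cofactor_orthogonal_image:
  assumes q: "q \<subseteq> {..<dim_row A}" "card q = Suc (dim_col A)" and x: "x \<in> carrier_vec (dim_col A)"
  shows "(\<Sum>k\<in>q. row_cofactor A q k * (A *\<^sub>v x) $ k) = 0"
proof -
  have "(\<Sum>k\<in>q. row_cofactor A q k * (A *\<^sub>v x) $ k)
      = (\<Sum>k\<in>q. \<Sum>j<dim_col A. x $ j * (row_cofactor A q k * A $$ (k, j)))"
    using q x
    by (intro sum.cong refl, subst index_mult_mat_vec_sum[of A "dim_row A" "dim_col A"])
       (auto simp: sum_distrib_left ac_simps)
  also have "\<dots> = (\<Sum>j<dim_col A. x $ j * (\<Sum>k\<in>q. row_cofactor A q k * A $$ (k, j)))"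
    by (subst sum.swap) (simp add: sum_distrib_left)
  finally show ?thesis using row_cofactor_orthogonal_col[OF q] by simp
qed

section \<open>Residuals of the weighted subsystem solutions\<close>

lemma mat_inv_nonsingular:
  assumes M: "M \<in> carrier_mat n n" and det: "det M \<noteq> 0"
  shows "mat_inv M \<in> carrier_mat n n" "M * mat_inv M = 1\<^sub>m n" "mat_inv M * M = 1\<^sub>m n"
proof -
  obtain B where "mat_inverse M = Some B"
    using mat_inverse(1)[OF M, of "()"] det_non_zero_imp_unit[OF M det, of "()"] by blast
  then show "mat_inv M \<in> carrier_mat n n" "M * mat_inv M = 1\<^sub>m n" "mat_inv M * M = 1\<^sub>m n"
    using mat_inverse(2)[OF M] by (simp_all add: mat_inv_def)
qed

lemma ls_weighted_term_carrier:
  assumes "p \<in> row_subsets A"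
  shows "ls_weighted_term A b p \<in> carrier_vec (dim_col A)"
proof -
  have "row_submatrix A p \<in> carrier_mat (dim_col A) (dim_col A)"
    using assms row_submatrix_carrier[of p A] by (auto simp: row_subsets_def)
  from mat_inv_nonsingular(1)[OF this] show ?thesis
    by (intro carrier_vecI) (auto simp: ls_weighted_term_def)
qed

text \<open>
  The residual of the solution of the square subsystem \<open>p\<close>, scaled by the weight of \<open>p\<close>.
  The weight is inside the definition so that singular subsystems contribute zero.
\<close>

definition weighted_residual :: "real mat \<Rightarrow> real vec \<Rightarrow> nat set \<Rightarrow> nat \<Rightarrow> real" where
  "weighted_residual A b p k =
     (det (row_submatrix A p))\<^sup>2 * b $ k - (A *\<^sub>v ls_weighted_term A b p) $ k"

lemma weighted_residual_selected_row:
  assumes p: "p \<in> row_subsets A" and b: "dim_vec b = dim_row A" and k: "k \<in> p"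
  shows "weighted_residual A b p k = 0"
proof (cases "det (row_submatrix A p) = 0")
  case True
  then show ?thesis
    using k p by (auto simp: weighted_residual_def ls_weighted_term_def row_subsets_def)
next
  case False
  let ?S = "row_submatrix A p" and ?n = "dim_col A"
  have sub: "p \<subseteq> {..<dim_row A}" and card: "card p = ?n" using p by (auto simp: row_subsets_def)
  have S: "?S \<in> carrier_mat ?n ?n" using row_submatrix_carrier[OF sub] card by simp
  note inv = mat_inv_nonsingular[OF S False]
  have sb: "subvec b p \<in> carrier_vec ?n"
    using sub b card by (intro carrier_vecI) (simp add: subvec_def inter_below)
  define x where "x = mat_inv ?S *\<^sub>v subvec b p"
  have x: "x \<in> carrier_vec ?n" using inv(1) sb by (simp add: x_def)
  have "subvec (A *\<^sub>v x) p = ?S *\<^sub>v x" using row_submatrix_mult_vec[OF sub x] by simp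
  also have "\<dots> = (?S * mat_inv ?S) *\<^sub>v subvec b p"
    unfolding x_def using assoc_mult_mat_vec[OF S inv(1) sb] by simp
  also have "\<dots> = subvec b p" using inv(2) sb by simp
  finally have "(A *\<^sub>v x) $ k = b $ k"
    using subvec_eq_iff[of p "A *\<^sub>v x" b] sub b k by simp
  moreover have "(A *\<^sub>v ls_weighted_term A b p) $ k = (det ?S)\<^sup>2 * (A *\<^sub>v x) $ k"
    using False k sub x mult_mat_vec[of A "dim_row A" ?n x]
    by (auto simp: ls_weighted_term_def x_def[symmetric])
  ultimately show ?thesis by (simp add: weighted_residual_def)
qed

text \<open>
  The residual vector of the subsystem \<open>q - {k}\<close> vanishes on \<open>q\<close> except at \<open>k\<close>. Pairing it with
  the row cofactors therefore isolates its \<open>k\<close>-th entry, while the same pairing kills the part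
  in the image of \<open>A\<close> and leaves only the bordered determinant of \<open>b\<close>.
\<close>

lemma weighted_residual_other_row:
  assumes q: "q \<subseteq> {..<dim_row A}" "card q = Suc (dim_col A)"
    and b: "dim_vec b = dim_row A" and k: "k \<in> q"
  shows "weighted_residual A b (q - {k}) k
    = row_cofactor A q k * (\<Sum>l\<in>q. row_cofactor A q l * b $ l)"
proof (cases "det (row_submatrix A (q - {k})) = 0")
  case True
  then show ?thesis
    using k q by (auto simp: weighted_residual_def ls_weighted_term_def row_cofactor_def)
next
  case False
  let ?p = "q - {k}" and ?c = "row_cofactor A q" and ?r = "weighted_residual A b (q - {k})"
  let ?w = "(det (row_submatrix A (q - {k})))\<^sup>2"
  have "finite q" using q(2) card.infinite by fastforce
  have p: "?p \<in> row_subsets A" using q k by (auto simp: row_subsets_def)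
  \<comment> \<open>The weight is the square of the cofactor because the sign squares to one.\<close>
  have square: "?w = ?c k * ?c k"
    by (simp add: row_cofactor_def power_mult_distrib flip: power2_eq_square power_mult)
  have "?c k * ?r k = (\<Sum>l\<in>q. ?c l * ?r l)"
    using weighted_residual_selected_row[OF p b] k \<open>finite q\<close> by (subst sum.remove[of q k]) auto
  also have "\<dots> = ?w * (\<Sum>l\<in>q. ?c l * b $ l) - (\<Sum>l\<in>q. ?c l * (A *\<^sub>v ls_weighted_term A b ?p) $ l)"
    by (simp add: weighted_residual_def right_diff_distrib sum_subtractf sum_distrib_left mult.left_commute)
  also have "\<dots> = ?c k * (?c k * (\<Sum>l\<in>q. ?c l * b $ l))"
    unfolding row_cofactor_orthogonal_image[OF q ls_weighted_term_carrier[OF p]] square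
    by (simp only: diff_0_right mult.assoc)
  finally have "?c k * ?r k = ?c k * (?c k * (\<Sum>l\<in>q. ?c l * b $ l))" .
  moreover have "?c k \<noteq> 0" using False by (simp add: row_cofactor_def)
  ultimately show ?thesis by (simp only: mult_cancel_left simp_thms)
qed

lemma finite_row_subsets: "finite (row_subsets A)"
  by (rule finite_subset[of _ "Pow {..<dim_row A}"]) (auto simp: row_subsets_def)

text \<open>
  The double sum over subsystems \<open>p\<close> and rows \<open>k \<notin> p\<close> becomes a sum over sets \<open>q = insert k p\<close>
  of \<open>n + 1\<close> rows and elements \<open>k \<in> q\<close>. For fixed \<open>q\<close> all terms share the bordered
  determinant of \<open>b\<close> as a factor, and what remains pairs the row cofactors with a column of \<open>A\<close>.
\<close>

lemma sum_weighted_residual_orthogonal: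
  assumes b: "dim_vec b = dim_row A" and j: "j < dim_col A"
  shows "(\<Sum>p\<in>row_subsets A. \<Sum>k<dim_row A. A $$ (k, j) * weighted_residual A b p k) = 0"
proof -
  let ?Q = "{q. q \<subseteq> {..<dim_row A} \<and> card q = Suc (dim_col A)}"
  let ?f = "\<lambda>p k. A $$ (k, j) * weighted_residual A b p k"
  let ?D = "\<lambda>q. \<Sum>l\<in>q. row_cofactor A q l * b $ l"
  have fin: "finite ?Q"
    by (rule finite_subset[of _ "Pow {..<dim_row A}"]) auto
  have fin_p: "finite p" if "p \<subseteq> {..<dim_row A}" for p
    using that finite_subset by blast
  have "(\<Sum>p\<in>row_subsets A. \<Sum>k<dim_row A. ?f p k)
      = (\<Sum>p\<in>row_subsets A. \<Sum>k\<in>{..<dim_row A} - p. ?f p k)"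
    by (intro sum.cong sum.mono_neutral_right) (auto simp: weighted_residual_selected_row[OF _ b])
  also have "\<dots> = (\<Sum>(p, k)\<in>(SIGMA p:row_subsets A. {..<dim_row A} - p). ?f p k)"
    by (rule sum.Sigma) (auto simp: finite_row_subsets)
  also have "\<dots> = (\<Sum>(q, k)\<in>(SIGMA q:?Q. q). ?f (q - {k}) k)"
    by (rule sum.reindex_bij_witness
          [where i = "\<lambda>(q, k). (q - {k}, k)" and j = "\<lambda>(p, k). (insert k p, k)"])
       (auto simp: row_subsets_def insert_absorb fin_p)
  also have "\<dots> = (\<Sum>q\<in>?Q. \<Sum>k\<in>q. ?f (q - {k}) k)"
    by (rule sum.Sigma[symmetric]) (use fin fin_p in auto)
  also have "\<dots> = (\<Sum>q\<in>?Q. ?D q * (\<Sum>k\<in>q. row_cofactor A q k * A $$ (k, j)))"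
    by (intro sum.cong refl, subst sum_distrib_left, intro sum.cong refl)
       (auto simp: weighted_residual_other_row[OF _ _ b])
  also have "\<dots> = 0"
    using row_cofactor_orthogonal_col[OF _ _ j] by (intro sum.neutral) auto
  finally show ?thesis .
qed

section \<open>Normal equations and least squares\<close>

lemma ls_denominator_nonzero:
  assumes "p \<in> row_subsets A" "det (row_submatrix A p) \<noteq> 0"
  shows "ls_denominator A \<noteq> 0"
proof -
  have "ls_denominator A > 0" unfolding ls_denominator_def
    by (rule sum_pos2[OF finite_row_subsets assms(1)]) (use assms(2) in auto)
  then show ?thesis by simp
qed

lemma ls_estimate_carrier: "ls_estimate A b \<in> carrier_vec (dim_col A)"
  using finsum_vec_closed[of "ls_weighted_term A b" "row_subsets A" "dim_col A"]
  by (auto simp: ls_estimate_def ls_weighted_term_carrier)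

lemma ls_estimate_residual:
  assumes b: "b \<in> carrier_vec (dim_row A)" and denom: "ls_denominator A \<noteq> 0" and k: "k < dim_row A"
  shows "ls_denominator A * (b - A *\<^sub>v ls_estimate A b) $ k
    = (\<Sum>p\<in>row_subsets A. weighted_residual A b p k)"
proof -
  let ?N = "finsum_vec TYPE(real) (dim_col A) (ls_weighted_term A b) (row_subsets A)"
  have A: "A \<in> carrier_mat (dim_row A) (dim_col A)" by simp
  have t: "ls_weighted_term A b \<in> row_subsets A \<rightarrow> carrier_vec (dim_col A)"
    using ls_weighted_term_carrier by auto
  have N: "?N \<in> carrier_vec (dim_col A)" by (rule finsum_vec_closed[OF t])
  have "(A *\<^sub>v ?N) $ k = (\<Sum>j<dim_col A. \<Sum>p\<in>row_subsets A. A $$ (k, j) * ls_weighted_term A b p $ j)"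
    unfolding index_mult_mat_vec_sum[OF A N k]
    by (intro sum.cong refl) (simp add: index_finsum_vec[OF finite_row_subsets _ t] sum_distrib_left)
  also have "\<dots> = (\<Sum>p\<in>row_subsets A. (A *\<^sub>v ls_weighted_term A b p) $ k)"
    by (subst sum.swap, intro sum.cong refl)
       (simp only: index_mult_mat_vec_sum[OF A ls_weighted_term_carrier k])
  finally have AN: "(A *\<^sub>v ?N) $ k = (\<Sum>p\<in>row_subsets A. (A *\<^sub>v ls_weighted_term A b p) $ k)" .
  have "(A *\<^sub>v ls_estimate A b) $ k = 1 / ls_denominator A * (A *\<^sub>v ?N) $ k"
    using mult_mat_vec[OF A N, of "1 / ls_denominator A"] k unfolding ls_estimate_def
    by (metis index_smult_vec(1) dim_mult_mat_vec)
  then have "ls_denominator A * (b - A *\<^sub>v ls_estimate A b) $ k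
      = ls_denominator A * b $ k - (A *\<^sub>v ?N) $ k"
    using k denom b by (simp add: right_diff_distrib del: index_mult_mat_vec)
  also have "\<dots> = (\<Sum>p\<in>row_subsets A. weighted_residual A b p k)"
    unfolding AN weighted_residual_def ls_denominator_def by (simp only: sum_subtractf sum_distrib_right)
  finally show ?thesis .
qed

lemma ls_estimate_normal_equations:
  assumes b: "b \<in> carrier_vec (dim_row A)" and denom: "ls_denominator A \<noteq> 0"
  shows "transpose_mat A *\<^sub>v (b - A *\<^sub>v ls_estimate A b) = 0\<^sub>v (dim_col A)"
proof (rule eq_vecI)
  let ?r = "b - A *\<^sub>v ls_estimate A b"
  fix j assume "j < dim_vec (0\<^sub>v (dim_col A))"
  then have j: "j < dim_col A" by simp
  have r: "?r \<in> carrier_vec (dim_row A)" using b by (intro carrier_vecI) simp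
  have "ls_denominator A * (transpose_mat A *\<^sub>v ?r) $ j
      = (\<Sum>k<dim_row A. A $$ (k, j) * (ls_denominator A * ?r $ k))"
    using j by (subst index_mult_mat_vec_sum[of _ "dim_col A" "dim_row A", OF _ r])
      (auto simp: sum_distrib_left ac_simps intro!: sum.cong)
  also have "\<dots> = (\<Sum>k<dim_row A. \<Sum>p\<in>row_subsets A. A $$ (k, j) * weighted_residual A b p k)"
    by (intro sum.cong refl) (simp only: ls_estimate_residual[OF b denom] lessThan_iff sum_distrib_left)
  also have "\<dots> = 0"
    using sum_weighted_residual_orthogonal[of b A j] b j by (subst sum.swap) simp
  finally show "(transpose_mat A *\<^sub>v ?r) $ j = 0\<^sub>v (dim_col A) $ j"
    using denom j by simp
qed simp

lemma scalar_prod_self_eq_0: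
  fixes v :: "real vec"
  assumes v: "v \<in> carrier_vec n"
  shows "v \<bullet> v = 0 \<longleftrightarrow> v = 0\<^sub>v n"
proof -
  have "v \<bullet> v = 0 \<longleftrightarrow> (\<forall>i<n. v $ i = 0)"
    using v by (auto simp: scalar_prod_def sum_nonneg_eq_0_iff)
  also have "\<dots> \<longleftrightarrow> v = 0\<^sub>v n"
    using v by (auto intro!: eq_vecI)
  finally show ?thesis .
qed

text \<open>If \<open>A\<^sup>T A x = 0\<close> then \<open>(A x) \<bullet> (A x) = x \<bullet> (A\<^sup>T A x) = 0\<close>, so \<open>A x = 0\<close>.\<close>

lemma det_gram_nonzero:
  fixes A :: "real mat"
  assumes A: "A \<in> carrier_mat m n"
    and inj: "\<forall>x\<in>carrier_vec n. A *\<^sub>v x = 0\<^sub>v m \<longrightarrow> x = 0\<^sub>v n"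
  shows "det (transpose_mat A * A) \<noteq> 0"
proof
  have G: "transpose_mat A * A \<in> carrier_mat n n" using A by simp
  assume "det (transpose_mat A * A) = 0"
  then obtain x where x: "x \<in> carrier_vec n" "x \<noteq> 0\<^sub>v n" "(transpose_mat A * A) *\<^sub>v x = 0\<^sub>v n"
    using det_0_iff_vec_prod_zero_field[OF G] by blast
  have Ax: "A *\<^sub>v x \<in> carrier_vec m" using A x by simp
  have "(A *\<^sub>v x) \<bullet> (A *\<^sub>v x) = (transpose_mat A *\<^sub>v (A *\<^sub>v x)) \<bullet> x"
    using transpose_vec_mult_scalar[OF A x(1) Ax] by simp
  also have "\<dots> = 0"
    using x assoc_mult_mat_vec[of "transpose_mat A" n m A n x] A by simp
  finally have "A *\<^sub>v x = 0\<^sub>v m"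
    using scalar_prod_self_eq_0[OF Ax] by simp
  then show False using inj x by blast
qed

text \<open>
  The normal equations say that the residual at \<open>z\<close> is orthogonal to the image of \<open>A\<close>. By Pythagoras,
  moving from \<open>z\<close> to \<open>y\<close> increases the squared error by that of \<open>A (y - z)\<close>, which
  vanishes only for \<open>y = z\<close>.
\<close>

lemma normal_equations_unique_minimizer:
  assumes A: "A \<in> carrier_mat m n" and b: "b \<in> carrier_vec m"
    and inj: "\<forall>x\<in>carrier_vec n. A *\<^sub>v x = 0\<^sub>v m \<longrightarrow> x = 0\<^sub>v n"
    and z: "z \<in> carrier_vec n" and normal: "transpose_mat A *\<^sub>v (b - A *\<^sub>v z) = 0\<^sub>v n"
  shows "least_square_solution A b x \<longleftrightarrow> x = z"
proof -
  let ?e = "\<lambda>y. euclidean_norm (A *\<^sub>v y - b)"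
  have pythagoras: "(A *\<^sub>v y - b) \<bullet> (A *\<^sub>v y - b)
      = (A *\<^sub>v (y - z)) \<bullet> (A *\<^sub>v (y - z)) + (A *\<^sub>v z - b) \<bullet> (A *\<^sub>v z - b)"
    if y: "y \<in> carrier_vec n" for y
  proof -
    define d r where "d = A *\<^sub>v (y - z)" and "r = b - A *\<^sub>v z"
    have d: "d \<in> carrier_vec m" and r: "r \<in> carrier_vec m"
      using A b y z by (auto simp: d_def r_def)
    have "A *\<^sub>v y - b = d - r" "A *\<^sub>v z - b = - r"
      using A b y z mult_minus_distrib_mat_vec[OF A y z] by (auto simp: d_def r_def intro!: eq_vecI)
    moreover have "r \<bullet> d = 0"
      using transpose_vec_mult_scalar[OF A _ r, of "y - z"] normal y z by (simp add: d_def r_def)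
    moreover have "d \<bullet> r = r \<bullet> d" using d r by (rule comm_scalar_prod)
    ultimately show ?thesis
      using d r unfolding d_def[symmetric]
      by (simp add: minus_scalar_prod_distrib[of _ m] scalar_prod_minus_distrib[of _ m])
  qed
  have less: "?e z < ?e y" if y: "y \<in> carrier_vec n" and "y \<noteq> z" for y
  proof -
    have "y - z \<noteq> 0\<^sub>v n" using that z by (auto simp: vec_eq_iff)
    then have "A *\<^sub>v (y - z) \<noteq> 0\<^sub>v m" using inj y z by auto
    then have "(A *\<^sub>v (y - z)) \<bullet> (A *\<^sub>v (y - z)) \<noteq> 0"
      using scalar_prod_self_eq_0[of "A *\<^sub>v (y - z)" m] A y z by simp
    moreover have "(A *\<^sub>v (y - z)) \<bullet> (A *\<^sub>v (y - z)) \<ge> 0"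
      unfolding scalar_prod_def by (intro sum_nonneg) simp
    ultimately show ?thesis using pythagoras[OF y] by (simp add: euclidean_norm_def)
  qed
  have "dim_col A = n" using A by simp
  then have "least_square_solution A b x \<longleftrightarrow>
      x \<in> carrier_vec n \<and> (\<forall>y\<in>carrier_vec n. \<not> ?e y < ?e x)"
    by (auto simp: least_square_solution_def is_arg_min_def)
  also have "\<dots> \<longleftrightarrow> x = z"
  proof
    assume "x \<in> carrier_vec n \<and> (\<forall>y\<in>carrier_vec n. \<not> ?e y < ?e x)"
    then show "x = z" using less[of x] z by blast
  next
    assume "x = z"
    moreover have "\<not> ?e y < ?e z" if "y \<in> carrier_vec n" for y
      using less[OF that] by (cases "y = z") auto
    ultimately show "x \<in> carrier_vec n \<and> (\<forall>y\<in>carrier_vec n. \<not> ?e y < ?e x)"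
      using z by blast
  qed
  finally show ?thesis .
qed

theorem theorem1:
  fixes m n :: nat and A :: "real mat" and b :: "real vec"
  assumes "1 \<le> n" and "n \<le> m"
    and "A \<in> carrier_mat m n"
    and "vec_space.rank m A = n"
    and "b \<in> carrier_vec m"
  shows "ls_denominator A \<noteq> 0
    \<and> invertible_mat (transpose_mat A * A)
    \<and> ls_estimate A b = mat_inv (transpose_mat A * A) *\<^sub>v (transpose_mat A *\<^sub>v b)
    \<and> (\<forall>x. least_square_solution A b x \<longleftrightarrow> x = ls_estimate A b)"
proof -
  note A = assms(3) and b = assms(5)
  note inj = full_column_rank_kernel[OF A assms(4)]
  let ?G = "transpose_mat A * A" and ?z = "ls_estimate A b"
  have dims: "dim_row A = m" "dim_col A = n" using carrier_matD[OF A] .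
  have At: "transpose_mat A \<in> carrier_mat n m" and G: "?G \<in> carrier_mat n n" using A by auto
  have z: "?z \<in> carrier_vec n" using ls_estimate_carrier dims by metis
  have denom: "ls_denominator A \<noteq> 0"
    using exists_nonzero_maximal_minor[OF A inj] ls_denominator_nonzero by metis
  note inv = mat_inv_nonsingular[OF G det_gram_nonzero[OF A inj]]
  have "invertible_mat ?G"
    unfolding invertible_mat_def inverts_mat_def using inv G dims
    by (auto intro!: exI[of _ "mat_inv ?G"])
  moreover have normal: "transpose_mat A *\<^sub>v (b - A *\<^sub>v ?z) = 0\<^sub>v n"
    using ls_estimate_normal_equations[OF _ denom] b dims by simp
  moreover have "?z = mat_inv ?G *\<^sub>v (transpose_mat A *\<^sub>v b)"
  proof -
    have "transpose_mat A *\<^sub>v b - ?G *\<^sub>v ?z = 0\<^sub>v n"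
      using normal mult_minus_distrib_mat_vec[OF At b, of "A *\<^sub>v ?z"]
        assoc_mult_mat_vec[OF At A z] A z by simp
    then have "?G *\<^sub>v ?z = transpose_mat A *\<^sub>v b"
      using A z At b G by (auto simp: vec_eq_iff simp del: index_mult_mat_vec)
    then have "mat_inv ?G *\<^sub>v (transpose_mat A *\<^sub>v b) = mat_inv ?G *\<^sub>v (?G *\<^sub>v ?z)" by simp
    also have "\<dots> = ?z"
      using assoc_mult_mat_vec[OF inv(1) G z] inv(3) z by simp
    finally show ?thesis by simp
  qed
  ultimately show ?thesis
    using denom normal_equations_unique_minimizer[OF A b inj z normal] by blast
qed

end
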